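(* Let $\Omega\subset\mathbb{R}^N$ ($N\geq 1$) be open and let $M$ be a $\Phi$-function on $\Omega$ which is locally integrable, i.e. $\int_K M(x,c)\,dx<\infty$ for every constant $c>0$ and every compact set $K\subset\Omega$. Then: (1) $\mathcal{C}^\infty_0(\Omega)$ is dense in $E_M(\Omega)$ with respect to the strong (norm) topology of $E_M(\Omega)$, i.e. the topology given by $\|\cdot\|_{L_M(\Omega)}$. (2) $\mathcal{C}^\infty_0(\Omega)$ is dense in $L_M(\Omega)$ with respect to the modular topology, i.e. every $u\in L_M(\Omega)$ is the limit in the modular sense of a sequence of functions in $\mathcal{C}^\infty_0(\Omega)$.
   Context: A function $M:\Omega\times[0,\infty)\to[0,\infty]$ is a $\phi$-function if for all $x\in\Omega$ the function $M(x,\cdot)$ is nondecreasing and convex with $M(x,0)=0$, $M(x,s)>0$ for $s>0$, $M(x,s)\to\infty$ as $s\to\infty$, and $M(\cdot,s)$ is measurable for every $s\geq0$. It is a $\Phi$-function if moreover $\lim_{s\to0^+}M(x,s)/s=0$ and $\lim_{s\to+\infty}M(x,s)/s=+\infty$ for all $x\in\Omega$. $L_M(\Omega)$ is the space of measurable $u:\Omega\to\mathbb{R}$ (modulo a.e. equality) with $\int_\Omega M(x,|u(x)|/\lambda)\,dx<\infty$ for some $\lambda>0$, with the Luxemburg norm $\|u\|_{L_M(\Omega)}=\inf\{\lambda>0:\int_\Omega M(x,|u(x)|/\lambda)\,dx\leq1\}$. $E_M(\Omega)$ is the subset of those $u$ with $\int_\Omega M(x,|u(x)|/\lambda)\,dx<\infty$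 for all $\lambda>0$. A sequence $u_n$ converges to $u$ in $L_M(\Omega)$ in the modular sense if there exists $\lambda>0$ with $\int_\Omega M(x,|u_n(x)-u(x)|/\lambda)\,dx\to0$ as $n\to\infty$. $\mathcal{C}^\infty_0(\Omega)$ is the set of infinitely differentiable functions with compact support in $\Omega$. *)

theory Defs
  imports "HOL-Analysis.Analysis"
begin

text \<open>
  The second argument of \<open>M\<close> is only meaningful on \<open>[0,\<infinity>)\<close>, so every condition below is restricted
  to \<open>s \<ge> 0\<close>.  In the convexity inequality the convention \<open>0 * \<infinity> = 0\<close> of \<^typ>\<open>ennreal\<close> is harmless:
  for \<open>\<theta> \<in> {0, 1}\<close> the inequality reads \<open>M x s \<le> M x s\<close> or \<open>M x t \<le> M x t\<close>.  Measurability is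
  Lebesgue measurability.
\<close>

definition phi_function :: "'a::euclidean_space set \<Rightarrow> ('a \<Rightarrow> real \<Rightarrow> ennreal) \<Rightarrow> bool" where
  "phi_function \<Omega> M \<longleftrightarrow>
     (\<forall>x\<in>\<Omega>.
        mono_on {0..} (M x) \<and>
        (\<forall>s\<ge>0. \<forall>t\<ge>0. \<forall>\<theta>\<in>{0..1}.
           M x ((1 - \<theta>) * s + \<theta> * t) \<le> ennreal (1 - \<theta>) * M x s + ennreal \<theta> * M x t) \<and>
        M x 0 = 0 \<and>
        (\<forall>s>0. M x s > 0) \<and>
        (M x \<longlongrightarrow> \<infinity>) at_top) \<and>
     (\<forall>s\<ge>0. (\<lambda>x. M x s) \<in> borel_measurable (lebesgue_on \<Omega>))"

definition Phi_function :: "'a::euclidean_space set \<Rightarrow> ('a \<Rightarrow> real \<Rightarrow> ennreal) \<Rightarrow> bool" where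
  "Phi_function \<Omega> M \<longleftrightarrow>
     phi_function \<Omega> M \<and>
     (\<forall>x\<in>\<Omega>. ((\<lambda>s. M x s / ennreal s) \<longlongrightarrow> 0) (at_right 0) \<and>
             ((\<lambda>s. M x s / ennreal s) \<longlongrightarrow> \<infinity>) at_top)"

definition locally_integrable_phi ::
    "'a::euclidean_space set \<Rightarrow> ('a \<Rightarrow> real \<Rightarrow> ennreal) \<Rightarrow> bool" where
  "locally_integrable_phi \<Omega> M \<longleftrightarrow>
     (\<forall>c>0. \<forall>K. compact K \<and> K \<subseteq> \<Omega> \<longrightarrow> (\<integral>\<^sup>+x. M x c \<partial>lebesgue_on K) < \<infinity>)"

definition modular ::
    "'a::euclidean_space set \<Rightarrow> ('a \<Rightarrow> real \<Rightarrow> ennreal) \<Rightarrow> ('a \<Rightarrow> real) \<Rightarrow> ennreal" where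
  "modular \<Omega> M u = (\<integral>\<^sup>+x. M x \<bar>u x\<bar> \<partial>lebesgue_on \<Omega>)"

text \<open>
  The spaces are sets of representatives: an element is a function on the whole space of which only
  the values on \<open>\<Omega>\<close> matter.  The modular, the norm and both kinds of convergence are invariant under
  changes on a null subset of \<open>\<Omega>\<close>, so density means the same as for the quotients modulo equality
  almost everywhere.
\<close>

definition L_space ::
    "'a::euclidean_space set \<Rightarrow> ('a \<Rightarrow> real \<Rightarrow> ennreal) \<Rightarrow> ('a \<Rightarrow> real) set" where
  "L_space \<Omega> M =
     {u \<in> borel_measurable (lebesgue_on \<Omega>). \<exists>r>0. modular \<Omega> M (\<lambda>x. u x / r) < \<infinity>}"

definition E_space ::
    "'a::euclidean_space set \<Rightarrow> ('a \<Rightarrow> real \<Rightarrow> ennreal) \<Rightarrow> ('a \<Rightarrow> real) set" where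
  "E_space \<Omega> M = {u \<in> L_space \<Omega> M. \<forall>r>0. modular \<Omega> M (\<lambda>x. u x / r) < \<infinity>}"

definition luxemburg_norm ::
    "'a::euclidean_space set \<Rightarrow> ('a \<Rightarrow> real \<Rightarrow> ennreal) \<Rightarrow> ('a \<Rightarrow> real) \<Rightarrow> real" where
  "luxemburg_norm \<Omega> M u = Inf {r. r > 0 \<and> modular \<Omega> M (\<lambda>x. u x / r) \<le> 1}"

definition modular_convergent ::
    "'a::euclidean_space set \<Rightarrow> ('a \<Rightarrow> real \<Rightarrow> ennreal) \<Rightarrow> (nat \<Rightarrow> 'a \<Rightarrow> real) \<Rightarrow> ('a \<Rightarrow> real) \<Rightarrow> bool"
  where
  "modular_convergent \<Omega> M U u \<longleftrightarrow>
     (\<exists>r>0. (\<lambda>n. modular \<Omega> M (\<lambda>x. (U n x - u x) / r)) \<longlonglongrightarrow> 0)"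

primrec C_k :: "nat \<Rightarrow> ('a::euclidean_space \<Rightarrow> real) \<Rightarrow> bool" where
  "C_k 0 f \<longleftrightarrow> continuous_on UNIV f"
| "C_k (Suc k) f \<longleftrightarrow>
     (\<forall>x. f differentiable (at x)) \<and> (\<forall>v. C_k k (\<lambda>x. frechet_derivative f (at x) v))"

text \<open>
  Functions with compact support in \<open>\<Omega>\<close> are identified with their extensions by zero, which are
  smooth on the whole space.
\<close>

definition test_functions :: "'a::euclidean_space set \<Rightarrow> ('a \<Rightarrow> real) set" where
  "test_functions \<Omega> =
     {f. (\<forall>k. C_k k f) \<and> compact (closure {x. f x \<noteq> 0}) \<and> closure {x. f x \<noteq> 0} \<subseteq> \<Omega>}"

definition norm_dense_in_E ::
    "'a::euclidean_space set \<Rightarrow> ('a \<Rightarrow> real \<Rightarrow> ennreal) \<Rightarrow> ('a \<Rightarrow> real) set \<Rightarrow> bool" where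
  "norm_dense_in_E \<Omega> M D \<longleftrightarrow>
     D \<subseteq> E_space \<Omega> M \<and>
     (\<forall>u\<in>E_space \<Omega> M. \<forall>\<epsilon>>0. \<exists>f\<in>D. luxemburg_norm \<Omega> M (\<lambda>x. f x - u x) < \<epsilon>)"

definition modular_dense_in_L ::
    "'a::euclidean_space set \<Rightarrow> ('a \<Rightarrow> real \<Rightarrow> ennreal) \<Rightarrow> ('a \<Rightarrow> real) set \<Rightarrow> bool" where
  "modular_dense_in_L \<Omega> M D \<longleftrightarrow>
     D \<subseteq> L_space \<Omega> M \<and>
     (\<forall>u\<in>L_space \<Omega> M. \<exists>U. (\<forall>n. U n \<in> D) \<and> modular_convergent \<Omega> M U u)"

end

theory Submission
  imports Defs
begin

text \<open>
  Both parts follow from one estimate: if \<open>u / r\<close> has finite modular, then \<open>(f - u) / (2 r)\<close> has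
  arbitrarily small modular for a suitable test function \<open>f\<close>; the factor \<open>2\<close> comes from convexity
  and separates two errors.  First, the truncation of \<open>u\<close> to a compact set and to bounded values
  converges to \<open>u\<close> in modular by dominated convergence with majorant \<open>M(x, |u| / r)\<close>.  Second, a
  bounded function supported in a compact subset of \<open>\<Omega>\<close> is an a.e. limit of uniformly bounded test
  functions supported in one compact subset of \<open>\<Omega>\<close>, and local integrability of \<open>M(x, c)\<close> provides
  the majorant.  Mollifiers are avoided: the test functions are polynomials from the
  Stone--Weierstrass theorem times a fixed smooth bump.
\<close>

subsection \<open>Smooth functions\<close>

lemma C_k_SucI:
  assumes "\<And>x. (f has_derivative f' x) (at x)"
    and "\<And>v. C_k k (\<lambda>x. f' x v)"
  shows "C_k (Suc k) f"
proof -
  \<comment> \<open>\<open>frechet_derivative\<close> is a choice operator; uniqueness of the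
    derivative lets any explicit formula \<open>f'\<close> stand in for it.\<close>
  have "frechet_derivative f (at x) = f' x" for x
    using frechet_derivative_at[OF assms(1)] by simp
  then show ?thesis
    using assms by (auto simp: differentiable_def)
qed

lemma C_k_SucD: "C_k (Suc k) f \<Longrightarrow> C_k k f"
proof (induction k arbitrary: f)
  case 0
  then show ?case
    by (auto intro!: differentiable_imp_continuous_within simp: continuous_on_eq_continuous_at)
next
  case (Suc k)
  have "C_k (Suc k) (\<lambda>x. frechet_derivative f (at x) v)" for v
    using Suc.prems by (subst (asm) C_k.simps(2)) blast
  then have "C_k k (\<lambda>x. frechet_derivative f (at x) v)" for v
    by (rule Suc.IH)
  then show ?case
    using Suc.prems by (subst C_k.simps(2)) (subst (asm) C_k.simps(2), blast)
qed

lemma C_k_Suc_has_derivative: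
  "C_k (Suc k) f \<Longrightarrow> (f has_derivative frechet_derivative f (at x)) (at x)"
  using frechet_derivative_works by auto

lemma C_k_const: "C_k k (\<lambda>x. c)"
proof (induction k arbitrary: c)
  case (Suc k)
  show ?case
    by (rule C_k_SucI[where f' = "\<lambda>x v. 0"]) (auto intro: Suc)
qed simp

lemma C_k_bounded_linear:
  assumes "bounded_linear f"
  shows "C_k k f"
proof (cases k)
  case 0
  then show ?thesis
    using assms by (simp add: linear_continuous_on)
next
  case (Suc m)
  show ?thesis
    unfolding Suc by (rule C_k_SucI[where f' = "\<lambda>x. f"])
      (auto intro: assms bounded_linear_imp_has_derivative C_k_const)
qed

lemma C_k_add: "C_k k f \<Longrightarrow> C_k k g \<Longrightarrow> C_k k (\<lambda>x. f x + g x)"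
proof (induction k arbitrary: f g)
  case 0
  then show ?case by (auto intro: continuous_intros)
next
  case (Suc k)
  show ?case
  proof (rule C_k_SucI)
    show "((\<lambda>x. f x + g x) has_derivative
        (\<lambda>v. frechet_derivative f (at x) v + frechet_derivative g (at x) v)) (at x)" for x
      using Suc.prems by (intro has_derivative_add C_k_Suc_has_derivative)
    show "C_k k (\<lambda>x. frechet_derivative f (at x) v + frechet_derivative g (at x) v)" for v
      using Suc.prems by (intro Suc.IH) simp_all
  qed
qed

lemma C_k_mult: "C_k k f \<Longrightarrow> C_k k g \<Longrightarrow> C_k k (\<lambda>x. f x * g x)"
proof (induction k arbitrary: f g)
  case 0
  then show ?case by (auto intro: continuous_intros)
next
  case (Suc k)
  \<comment> \<open>Each term of the product rule keeps one factor undifferentiated, so the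
    induction hypothesis is also applied to \<open>f\<close> and \<open>g\<close> themselves, one
    order lower.\<close>
  have "C_k k f" "C_k k g"
    using Suc.prems C_k_SucD by blast+
  show ?case
  proof (rule C_k_SucI)
    show "((\<lambda>x. f x * g x) has_derivative
        (\<lambda>v. f x * frechet_derivative g (at x) v + frechet_derivative f (at x) v * g x)) (at x)" for x
      using Suc.prems by (intro has_derivative_mult C_k_Suc_has_derivative)
    show "C_k k (\<lambda>x. f x * frechet_derivative g (at x) v + frechet_derivative f (at x) v * g x)" for v
      using Suc.prems \<open>C_k k f\<close> \<open>C_k k g\<close> by (intro C_k_add Suc.IH) simp_all
  qed
qed

lemma C_k_sum: "(\<And>i. i \<in> I \<Longrightarrow> C_k k (f i)) \<Longrightarrow> C_k k (\<lambda>x. \<Sum>i\<in>I. f i x)"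
  by (induction I rule: infinite_finite_induct) (auto intro: C_k_const C_k_add)

lemma C_k_real_polynomial_function: "real_polynomial_function p \<Longrightarrow> C_k k p"
  by (induction rule: real_polynomial_function.induct)
    (auto intro: C_k_bounded_linear C_k_const C_k_add C_k_mult)

section \<open>Flat functions and smooth bumps\<close>

text \<open>The family is closed under differentiation; \<open>flat_exp 1\<close> is the classical \<open>exp (- 1 / t)\<close>.\<close>

definition flat_exp :: "real poly \<Rightarrow> real \<Rightarrow> real" where
  "flat_exp p t = (if t > 0 then poly p (1 / t) * exp (- (1 / t)) else 0)"

text \<open>With y = 1 / t the limit from the right becomes a limit at infinity, where each monomial
  \<open>y ^ i\<close> is beaten by \<open>exp y\<close>. From the left the function is constantly
  0.\<close>

lemma flat_exp_tendsto_0: "(flat_exp p \<longlongrightarrow> 0) (at 0)"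
proof -
  have "((\<lambda>y. \<Sum>i\<le>degree p. coeff p i * (y ^ i / exp y)) \<longlongrightarrow> (\<Sum>i\<le>degree p. coeff p i * 0)) at_top"
    by (intro tendsto_intros tendsto_power_div_exp_0)
  then have "((\<lambda>y. poly p y * exp (- y)) \<longlongrightarrow> 0) at_top"
    by (simp add: poly_altdef sum_distrib_right exp_minus divide_inverse mult.assoc)
  then have "((\<lambda>t. poly p (inverse t) * exp (- inverse t)) \<longlongrightarrow> 0) (at_right 0)"
    by (rule filterlim_compose[OF _ filterlim_inverse_at_top_right])
  then have right: "(flat_exp p \<longlongrightarrow> 0) (at_right 0)"
    by (rule Lim_transform_eventually)
      (auto simp: eventually_at_right_less flat_exp_def divide_inverse
        intro!: eventually_mono[OF eventually_at_right_less])
  have left: "(flat_exp p \<longlongrightarrow> 0) (at_left 0)"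
    by (rule tendsto_eventually) (auto simp: flat_exp_def eventually_at_filter)
  show ?thesis
    using left right by (simp add: filterlim_at_split)
qed

text \<open>For t > 0 and y = 1 / t, differentiating p(y) exp(-y) in t brings out the factor -y^2
  and leaves y^2 (p - p')(y) exp(-y); \<open>monom 1 2\<close> is y^2. Only t = 0 needs the
  definition of the derivative.\<close>

lemma flat_exp_has_real_derivative:
  "(flat_exp p has_real_derivative flat_exp (monom 1 2 * (p - pderiv p)) t) (at t)"
proof -
  consider "t > 0" | "t < 0" | "t = 0" by linarith
  then show ?thesis
  proof cases
    case 1
    have "((\<lambda>t. poly p (1 / t) * exp (- (1 / t))) has_real_derivative
        flat_exp (monom 1 2 * (p - pderiv p)) t) (at t)"
      using 1 by (auto intro!: derivative_eq_intros DERIV_chain2[OF poly_DERIV]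
          simp: flat_exp_def poly_monom field_simps power2_eq_square)
    then show ?thesis
      by (rule has_field_derivative_transform_within_open[where S = "{0<..}"])
        (use 1 in \<open>auto simp: flat_exp_def\<close>)
  next
    case 2
    have "((\<lambda>t. 0) has_real_derivative flat_exp (monom 1 2 * (p - pderiv p)) t) (at t)"
      using 2 by (auto simp: flat_exp_def)
    then show ?thesis
      by (rule has_field_derivative_transform_within_open[where S = "{..<0}"])
        (use 2 in \<open>auto simp: flat_exp_def\<close>)
  next
    case 3
    \<comment> \<open>Dividing by h multiplies the polynomial in 1 / h by its variable, which is
      what \<open>pCons 0\<close> does. At h = 0 both sides are 0, since division by zero yields
      0.\<close>
    have "(\<lambda>h. (flat_exp p (0 + h) - flat_exp p 0) / h) = flat_exp (pCons 0 p)"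
      by (auto simp: flat_exp_def fun_eq_iff)
    then have "(flat_exp p has_real_derivative 0) (at 0)"
      using flat_exp_tendsto_0[of "pCons 0 p"] by (simp add: DERIV_def)
    then show ?thesis
      using 3 by (simp add: flat_exp_def)
  qed
qed

text \<open>The chain rule replaces \<open>p\<close> by another polynomial, so the induction on
  \<open>k\<close> runs over all \<open>p\<close> at once. Each step takes one derivative of
  \<open>q\<close>, which stays as a factor.\<close>

lemma C_k_flat_exp_compose:
  assumes "\<And>k. C_k k q"
  shows "C_k k (\<lambda>x. flat_exp p (q x))"
proof (induction k arbitrary: p)
  case 0
  have "continuous_on UNIV (flat_exp p)"
    by (meson DERIV_continuous_on flat_exp_has_real_derivative has_field_derivative_at_within)
  then show ?case
    using assms[of 0] continuous_on_compose2 by fastforce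
next
  case (Suc k)
  have "((\<lambda>x. flat_exp p (q x)) has_derivative
      (\<lambda>v. flat_exp (monom 1 2 * (p - pderiv p)) (q x) * frechet_derivative q (at x) v)) (at x)" for x
    using has_derivative_compose[OF C_k_Suc_has_derivative[OF assms]
        flat_exp_has_real_derivative[unfolded has_field_derivative_def]] by blast
  moreover have "C_k k (\<lambda>x. frechet_derivative q (at x) v)" for v
    using assms[of "Suc k"] by simp
  ultimately show ?case
    by (intro C_k_SucI) (auto intro: C_k_mult Suc)
qed

text \<open>No cutoff equal to \<open>1\<close> on \<open>K\<close> is needed: to approximate \<open>w\<close> supported in \<open>K\<close>, one approximates
  \<open>w / S\<close> by polynomials and multiplies by \<open>S\<close>.\<close>

lemma smooth_positive_on_compact:
  fixes K :: "'a::euclidean_space set"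
  assumes "open \<Omega>" "compact K" "K \<subseteq> \<Omega>"
  obtains S where "\<And>k. C_k k S" "\<And>x. S x \<ge> 0" "\<And>x. x \<in> K \<Longrightarrow> S x > 0"
    "compact (closure {x. S x \<noteq> 0})" "closure {x. S x \<noteq> 0} \<subseteq> \<Omega>"
proof -
  have "\<exists>r>0. cball y r \<subseteq> \<Omega>" if "y \<in> K" for y
    using assms that open_contains_cball by blast
  then obtain r where r: "\<And>y. y \<in> K \<Longrightarrow> r y > 0" "\<And>y. y \<in> K \<Longrightarrow> cball y (r y) \<subseteq> \<Omega>"
    by metis
  have "K \<subseteq> (\<Union>y\<in>K. ball y (r y))"
    using r(1) by (meson UN_I centre_in_ball subsetI)
  then obtain F where F: "F \<subseteq> K" "finite F" "K \<subseteq> (\<Union>y\<in>F. ball y (r y))"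
    using compactE_image[OF assms(2), of K "\<lambda>y. ball y (r y)"] by auto
  \<comment> \<open>A finite sum of bumps, each positive exactly on its open ball. The squared
    distance makes the inner function a polynomial in the coordinates, hence smooth at the centre
    too.\<close>
  define S where "S = (\<lambda>x. \<Sum>y\<in>F. flat_exp 1 ((r y)\<^sup>2 - (x - y) \<bullet> (x - y)))"
  have in_ball: "(r y)\<^sup>2 - (x - y) \<bullet> (x - y) > 0 \<longleftrightarrow> x \<in> ball y (r y)" if "y \<in> F" for x y
  proof -
    have "r y > 0"
      using F(1) r(1) that by blast
    then have "(r y)\<^sup>2 \<le> (norm (x - y))\<^sup>2 \<longleftrightarrow> r y \<le> norm (x - y)"
      by (intro power_mono_iff) auto
    then show ?thesis
      by (simp only: mem_ball dist_norm norm_minus_commute[of y x] power2_norm_eq_inner) linarith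
  qed
  have nonneg: "flat_exp 1 t \<ge> 0" for t
    by (simp add: flat_exp_def)
  have "C_k k (\<lambda>x. (r y)\<^sup>2 - (x - y) \<bullet> (x - y))" for k y
  proof -
    have "(x - y) \<bullet> (x - y) = (\<Sum>b\<in>Basis. (x \<bullet> b + - (y \<bullet> b)) * (x \<bullet> b + - (y \<bullet> b)))" for x
      by (subst euclidean_inner) (simp add: inner_diff_left)
    then have "(r y)\<^sup>2 - (x - y) \<bullet> (x - y)
        = (r y)\<^sup>2 + (\<Sum>b\<in>Basis. (- 1) * ((x \<bullet> b + - (y \<bullet> b)) * (x \<bullet> b + - (y \<bullet> b))))" for x
      by (simp add: sum_negf)
    then show ?thesis
      by (simp only:) (intro C_k_add C_k_mult C_k_sum C_k_const C_k_bounded_linear bounded_linear_inner_left)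
  qed
  then have 1: "C_k k S" for k
    unfolding S_def by (intro C_k_sum C_k_flat_exp_compose)
  have 2: "S x \<ge> 0" for x
    unfolding S_def by (intro sum_nonneg nonneg)
  have 3: "S x > 0" if "x \<in> K" for x
  proof -
    obtain y where y: "y \<in> F" "x \<in> ball y (r y)"
      using F(3) \<open>x \<in> K\<close> by blast
    then have "flat_exp 1 ((r y)\<^sup>2 - (x - y) \<bullet> (x - y)) > 0"
      using in_ball[of y x] by (simp add: flat_exp_def)
    then show ?thesis
      unfolding S_def using F y by (intro sum_pos2[of _ y]) (auto intro: nonneg)
  qed
  \<comment> \<open>The closed balls were chosen inside \<Omega>, so this finite union is a compact
    subset of \<Omega> that contains the support of \<open>S\<close>.\<close>
  define L where "L = (\<Union>y\<in>F. cball y (r y))"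
  have L: "compact L" "L \<subseteq> \<Omega>"
    unfolding L_def using F(1,2) r(2) by (auto simp del: mem_cball)
  have "S x = 0" if "x \<notin> L" for x
  proof -
    have "flat_exp 1 ((r y)\<^sup>2 - (x - y) \<bullet> (x - y)) = 0" if "y \<in> F" for y
      using in_ball[OF that, of x] \<open>x \<notin> L\<close> that by (auto simp: L_def flat_exp_def)
    then show ?thesis
      unfolding S_def by simp
  qed
  then have "closure {x. S x \<noteq> 0} \<subseteq> L"
    using L(1) by (intro closure_minimal) (auto simp: compact_imp_closed)
  then have "compact (closure {x. S x \<noteq> 0})" "closure {x. S x \<noteq> 0} \<subseteq> \<Omega>"
    using L compact_Int_closed[OF L(1) closed_closure, of "{x. S x \<noteq> 0}"]
    by (simp_all only: Int_absorb1)
  with 1 2 3 show ?thesis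
    using that by blast
qed

section \<open>Test functions and almost everywhere approximation\<close>

lemma C_k_continuous_on: "C_k k f \<Longrightarrow> continuous_on UNIV f"
  by (induction k) (auto dest: C_k_SucD simp del: C_k.simps(2))

lemma test_functionsI:
  assumes "\<And>k. C_k k f" "compact L" "L \<subseteq> \<Omega>" "\<And>x. x \<notin> L \<Longrightarrow> f x = 0"
  shows "f \<in> test_functions \<Omega>"
proof -
  have "closure {x. f x \<noteq> 0} \<subseteq> L"
    using assms by (intro closure_minimal) (auto simp: compact_imp_closed)
  moreover from this have "compact (closure {x. f x \<noteq> 0})"
    using compact_Int_closed[OF assms(2) closed_closure, of "{x. f x \<noteq> 0}"]
    by (simp only: Int_absorb1)
  ultimately show ?thesis
    using assms unfolding test_functions_def by auto
qed

lemma test_functions_scale: "f \<in> test_functions \<Omega> \<Longrightarrow> (\<lambda>x. c * f x) \<in> test_functions \<Omega>"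
  using closure_subset[of "{x. f x \<noteq> 0}"]
  by (intro test_functionsI[of _ "closure {x. f x \<noteq> 0}"] C_k_mult C_k_const)
    (auto simp: test_functions_def)

lemma continuous_on_test_function: "f \<in> test_functions \<Omega> \<Longrightarrow> continuous_on UNIV f"
  by (auto simp: test_functions_def intro: C_k_continuous_on)

lemma borel_measurable_test_function:
  assumes "f \<in> test_functions \<Omega>" "open \<Omega>"
  shows "f \<in> borel_measurable (lebesgue_on \<Omega>)"
proof (rule continuous_imp_measurable_on_sets_lebesgue)
  show "continuous_on \<Omega> f"
    using continuous_on_test_function[OF assms(1)] by (rule continuous_on_subset) simp
  show "\<Omega> \<in> sets lebesgue"
    using assms(2) by simp
qed

lemma bounded_measurable_AE_limit_of_test_functions:
  fixes w :: "'a::euclidean_space \<Rightarrow> real"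
  assumes "open \<Omega>" "compact K" "K \<subseteq> \<Omega>"
    and w: "w \<in> borel_measurable lebesgue" "\<And>x. \<bar>w x\<bar> \<le> B" "\<forall>x. x \<notin> K \<longrightarrow> w x = 0"
  shows "\<exists>f L B'. (\<forall>n. f n \<in> test_functions \<Omega>) \<and> compact L \<and> L \<subseteq> \<Omega> \<and>
    (\<forall>n x. \<bar>f n x\<bar> \<le> B') \<and> (\<forall>n x. x \<notin> L \<longrightarrow> f n x = 0) \<and>
    (AE x in lebesgue. (\<lambda>n. f n x) \<longlonglongrightarrow> w x)"
proof -
  obtain S where S: "\<And>k. C_k k S" "\<And>x. S x \<ge> 0" "\<And>x. x \<in> K \<Longrightarrow> S x > 0"
    "compact (closure {x. S x \<noteq> 0})" "closure {x. S x \<noteq> 0} \<subseteq> \<Omega>"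
    using smooth_positive_on_compact[OF assms(1-3)] by blast
  define L where "L = closure {x. S x \<noteq> 0}"
  have L: "compact L" "L \<subseteq> \<Omega>" and L0: "\<And>x. x \<notin> L \<Longrightarrow> S x = 0"
    using S(4,5) closure_subset[of "{x. S x \<noteq> 0}"] by (auto simp: L_def)
  have contS: "continuous_on X S" for X
    using C_k_continuous_on[OF S(1)] continuous_on_subset by blast
  \<comment> \<open>The positive minimum of \<open>S\<close> on \<open>K\<close> keeps the quotient
    \<open>w / S\<close> bounded. For empty \<open>K\<close> any positive constant serves.\<close>
  obtain s0 where s0: "s0 > 0" "\<And>x. x \<in> K \<Longrightarrow> s0 \<le> S x"
  proof (cases "K = {}")
    case False
    then obtain y where "y \<in> K" "\<forall>x\<in>K. S y \<le> S x"
      using continuous_attains_inf[OF assms(2) _ contS] by blast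
    then show ?thesis
      using that[of "S y"] S(3) by blast
  qed (use that[of 1] in auto)
  have "bounded (S ` L)"
    using compact_continuous_image[OF contS L(1)] compact_imp_bounded by blast
  then obtain s1 where s1: "s1 > 0" "\<And>x. x \<in> L \<Longrightarrow> \<bar>S x\<bar> \<le> s1"
    by (auto simp: bounded_pos)
  define v where "v = (\<lambda>x. w x / S x)"
  define V where "V = \<bar>B\<bar> / s0"
  have "V \<ge> 0"
    using s0(1) by (simp add: V_def)
  \<comment> \<open>Off \<open>K\<close> the numerator vanishes, so the identity also holds where
    \<open>S\<close> is 0.\<close>
  have Sv: "S x * v x = w x" for x
    using S(3)[of x] w(3) by (cases "x \<in> K") (auto simp: v_def)
  have vV: "\<bar>v x\<bar> \<le> V" for x
  proof (cases "x \<in> K")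
    case True
    have "\<bar>w x\<bar> / S x \<le> \<bar>B\<bar> / s0"
      using True s0 w(2)[of x] by (intro frac_le) auto
    then show ?thesis
      using S(2)[of x] by (simp add: v_def V_def abs_divide)
  qed (use w(3) \<open>V \<ge> 0\<close> in \<open>auto simp: v_def\<close>)
  have "S \<in> borel_measurable lebesgue"
    using borel_measurable_continuous_onI[OF contS] by (simp add: measurable_completion)
  then have "v \<in> borel_measurable lebesgue"
    unfolding v_def using w(1) by measurable
  then have "v measurable_on UNIV"
    by (simp add: lebesgue_measurable_imp_measurable_on)
  \<comment> \<open>\<open>measurable_on\<close> supplies continuous functions converging to
    \<open>v\<close> off a negligible set; no bound on them comes with it.\<close>
  then obtain N g where N: "negligible N" and g: "\<And>n. continuous_on UNIV (g n)"
    and lim: "\<And>x. x \<notin> N \<Longrightarrow> (\<lambda>n. g n x) \<longlonglongrightarrow> v x"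
    by (auto simp: measurable_on_def)
  \<comment> \<open>Clipping to [-V, V] gives the uniform bound. The limit is unchanged because
    \<open>v\<close> takes its values in that interval.\<close>
  define h where "h = (\<lambda>n x. max (- V) (min V (g n x)))"
  have conth: "continuous_on L (h n)" for n
    unfolding h_def using continuous_on_subset[OF g] by (intro continuous_intros) auto
  have hV: "\<bar>h n x\<bar> \<le> V" for n x
    using \<open>V \<ge> 0\<close> by (auto simp: h_def)
  have limh: "(\<lambda>n. h n x) \<longlonglongrightarrow> v x" if "x \<notin> N" for x
  proof -
    have "(\<lambda>n. h n x) \<longlonglongrightarrow> max (- V) (min V (v x))"
      unfolding h_def by (intro tendsto_intros lim that)
    moreover have "max (- V) (min V (v x)) = v x"
      using vV[of x] by auto
    ultimately show ?thesis by simp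
  qed
  \<comment> \<open>The polynomial is controlled only on \<open>L\<close>; the factor
    \<open>S\<close> removes its values elsewhere.\<close>
  have "\<exists>p. real_polynomial_function p \<and> (\<forall>x\<in>L. \<bar>h n x - p x\<bar> < 1 / Suc n)" for n
    by (rule Stone_Weierstrass_real_polynomial_function[OF L(1) conth, of "1 / Suc n"]) auto
  then obtain p where p: "\<And>n. real_polynomial_function (p n)"
    "\<And>n x. x \<in> L \<Longrightarrow> \<bar>h n x - p n x\<bar> < 1 / Suc n"
    by metis
  define f where "f = (\<lambda>n x. S x * p n x)"
  have f0: "f n x = 0" if "x \<notin> L" for n x
    using L0[OF that] by (simp add: f_def)
  have f_test: "f n \<in> test_functions \<Omega>" for n
    unfolding f_def using L L0
    by (intro test_functionsI[of _ L] C_k_mult S(1) C_k_real_polynomial_function p(1)) auto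
  have f_bound: "\<bar>f n x\<bar> \<le> s1 * (V + 1)" for n x
  proof (cases "x \<in> L")
    case True
    have "1 / Suc n \<le> (1::real)"
      by simp
    then have "\<bar>p n x\<bar> \<le> V + 1"
      using p(2)[OF True, of n] hV[of n x] by linarith
    then show ?thesis
      using s1(2)[OF True] s1(1) by (auto simp: f_def abs_mult intro!: mult_mono)
  qed (use f0 s1(1) \<open>V \<ge> 0\<close> in auto)
  have "(\<lambda>n. f n x) \<longlonglongrightarrow> w x" if "x \<notin> N" for x
  proof (cases "x \<in> L")
    case True
    have "(\<lambda>n. h n x - p n x) \<longlonglongrightarrow> 0"
      by (rule Lim_null_comparison[OF _ LIMSEQ_Suc[OF lim_1_over_n]])
        (use p(2)[OF True] in \<open>auto simp: less_imp_le\<close>)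
    from tendsto_diff[OF limh[OF that] this] have "(\<lambda>n. p n x) \<longlonglongrightarrow> v x"
      by simp
    from tendsto_mult_left[OF this, of "S x"] show ?thesis
      by (simp add: f_def Sv)
  next
    case False
    then show ?thesis
      using f0[OF False] L0[OF False] Sv[of x] by simp
  qed
  then have "AE x in lebesgue. (\<lambda>n. f n x) \<longlonglongrightarrow> w x"
    using N by (intro AE_I'[of N]) (auto simp: negligible_iff_null_sets)
  then show ?thesis
    using f_test L f_bound f0 by (intro exI[of _ f] exI[of _ L] exI[of _ "s1 * (V + 1)"] conjI allI impI)
qed

subsection \<open>Modular approximation\<close>

text \<open>Finiteness at every point of \<Omega> makes each \<open>M x\<close> a real convex
  function, so the continuity arguments below hold pointwise. Local integrability alone yields
  finiteness only almost everywhere; the final proof passes to such an integrand.\<close>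

locale finite_convex_integrand =
  fixes \<Omega> :: "'a::euclidean_space set" and M :: "'a \<Rightarrow> real \<Rightarrow> ennreal"
  assumes open_domain: "open \<Omega>"
    and mono: "x \<in> \<Omega> \<Longrightarrow> 0 \<le> s \<Longrightarrow> s \<le> t \<Longrightarrow> M x s \<le> M x t"
    and convex: "x \<in> \<Omega> \<Longrightarrow> 0 \<le> s \<Longrightarrow> 0 \<le> t \<Longrightarrow> 0 \<le> \<theta> \<Longrightarrow> \<theta> \<le> 1 \<Longrightarrow>
      M x ((1 - \<theta>) * s + \<theta> * t) \<le> ennreal (1 - \<theta>) * M x s + ennreal \<theta> * M x t"
    and zero: "x \<in> \<Omega> \<Longrightarrow> M x 0 = 0"
    and finite: "x \<in> \<Omega> \<Longrightarrow> 0 \<le> s \<Longrightarrow> M x s < \<infinity>"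
    and measurable_section: "0 \<le> s \<Longrightarrow> (\<lambda>x. M x s) \<in> borel_measurable (lebesgue_on \<Omega>)"
    and locally_integrable: "compact K \<Longrightarrow> K \<subseteq> \<Omega> \<Longrightarrow> 0 < c \<Longrightarrow> (\<integral>\<^sup>+x. M x c \<partial>lebesgue_on K) < \<infinity>"
begin

section \<open>Measurability and convexity estimates for the integrand\<close>

text \<open>Left continuity of \<open>M x\<close>, in a form that turns \<open>M x \<bar>u x\<bar>\<close> into a countable supremum of
  measurable functions.\<close>

lemma eq_SUP_rational:
  assumes "x \<in> \<Omega>" "0 \<le> t"
  shows "M x t = (SUP q\<in>\<rat> \<inter> {0..}. if q \<le> t then M x q else 0)" (is "_ = ?S")
proof (rule antisym)
  show "?S \<le> M x t"
    using assms by (intro SUP_least) (auto intro: mono)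
  show "M x t \<le> ?S"
  proof (cases "t = 0")
    case True
    then show ?thesis
      using zero assms by simp
  next
    case False
    show ?thesis
    proof (rule ennreal_le_epsilon)
      fix e :: real assume "0 < e"
      obtain m where m: "M x (t + 1) = ennreal m" "0 \<le> m"
        using finite[of x "t + 1"] assms by (cases "M x (t + 1)") auto
      \<comment> \<open>The distance from \<open>q\<close> to \<open>t\<close> is kept below e / (m
        + 1) so that \<open>\<theta> * m\<close> is at most \<open>e\<close>; adding 1 avoids a zero
        denominator.\<close>
      have "max 0 (t - e / (m + 1)) < t"
        using False assms \<open>0 < e\<close> m by auto
      then obtain q where q: "q \<in> \<rat>" "max 0 (t - e / (m + 1)) < q" "q < t"
        using Rats_dense_in_real by blast
      \<comment> \<open>The weight that makes \<open>t\<close> a convex combination of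
        \<open>q\<close> and \<open>t + 1\<close>. Its denominator is at least 1, whence
        \<open>\<theta> \<le> t - q\<close>.\<close>
      define \<theta> where "\<theta> = (t - q) / (t + 1 - q)"
      have \<theta>: "0 \<le> \<theta>" "\<theta> \<le> 1" "\<theta> \<le> t - q"
        using q by (auto simp: \<theta>_def divide_simps mult_le_cancel_left1)
      have "(1 - \<theta>) * q + \<theta> * (t + 1) = q + \<theta> * (t + 1 - q)"
        by (simp add: algebra_simps)
      then have t: "(1 - \<theta>) * q + \<theta> * (t + 1) = t"
        using q by (simp add: \<theta>_def)
      have "\<theta> * m \<le> e / (m + 1) * (m + 1)"
        using \<theta> q m by (intro mult_mono) auto
      then have \<theta>m: "\<theta> * m \<le> e"
        using m by simp
      have "M x t \<le> ennreal (1 - \<theta>) * M x q + ennreal \<theta> * M x (t + 1)"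
        using convex[of x q "t + 1" \<theta>] t assms q \<theta> by auto
      also have "\<dots> \<le> 1 * M x q + ennreal e"
        using \<theta> \<theta>m m by (intro add_mono mult_right_mono)
          (auto simp: ennreal_mult[symmetric] ennreal_leI)
      also have "M x q \<le> ?S"
        using q by (intro SUP_upper2[of q]) auto
      finally show "M x t \<le> ?S + ennreal e"
        by (simp add: add_mono)
    qed
  qed
qed

lemma measurable_compose_abs:
  assumes [measurable]: "u \<in> borel_measurable (lebesgue_on \<Omega>)"
  shows "(\<lambda>x. M x \<bar>u x\<bar>) \<in> borel_measurable (lebesgue_on \<Omega>)"
proof -
  have "(\<lambda>x. SUP q\<in>\<rat> \<inter> {0..}. if q \<le> \<bar>u x\<bar> then M x q else 0) \<in> borel_measurable (lebesgue_on \<Omega>)"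
  proof (rule borel_measurable_SUP)
    show "countable (\<rat> \<inter> {0..} :: real set)"
      by (simp add: countable_rat)
    fix q :: real assume "q \<in> \<rat> \<inter> {0..}"
    then have [measurable]: "(\<lambda>x. M x q) \<in> borel_measurable (lebesgue_on \<Omega>)"
      by (simp add: measurable_section)
    show "(\<lambda>x. if q \<le> \<bar>u x\<bar> then M x q else 0) \<in> borel_measurable (lebesgue_on \<Omega>)"
      by measurable
  qed
  then show ?thesis
    by (rule measurable_cong[THEN iffD1, rotated]) (rule eq_SUP_rational[symmetric], auto)
qed

text \<open>Convexity between 0 and 1, together with \<open>M x 0 = 0\<close>, gives M(x, a) \<le> a
  M(x, 1) for 0 \<le> a \<le> 1.\<close>

lemma tendsto_at_0:
  assumes "x \<in> \<Omega>" "a \<longlonglongrightarrow> 0" "\<And>n. 0 \<le> a n"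
  shows "(\<lambda>n. M x (a n)) \<longlonglongrightarrow> 0"
proof -
  obtain m where m: "M x 1 = ennreal m" "0 \<le> m"
    using finite[of x 1] assms by (cases "M x 1") auto
  have "(\<lambda>n. ennreal (a n * m)) \<longlonglongrightarrow> ennreal (0 * m)"
    by (intro tendsto_intros tendsto_ennrealI assms)
  then have upper: "(\<lambda>n. ennreal (a n * m)) \<longlonglongrightarrow> 0"
    by simp
  have "\<forall>\<^sub>F n in sequentially. a n < 1"
    using assms(2) by (rule order_tendstoD) simp
  then have "\<forall>\<^sub>F n in sequentially. M x (a n) \<le> ennreal (a n * m)"
  proof eventually_elim
    case (elim n)
    then show ?case
      using convex[of x 0 1 "a n"] assms(1) assms(3)[of n] m by (simp add: zero ennreal_mult)
  qed
  then show ?thesis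
    by (intro tendsto_sandwich[OF _ _ tendsto_const upper]) auto
qed

text \<open>Replaces the triangle inequality, which the modular lacks in general: convexity at the
  midpoint, with the outer factors 1/2 enlarged to 1.\<close>

lemma modular_average_le:
  assumes "f \<in> borel_measurable (lebesgue_on \<Omega>)" "g \<in> borel_measurable (lebesgue_on \<Omega>)"
  shows "modular \<Omega> M (\<lambda>x. (f x + g x) / 2) \<le> modular \<Omega> M f + modular \<Omega> M g"
proof -
  have "M x \<bar>(f x + g x) / 2\<bar> \<le> M x \<bar>f x\<bar> + M x \<bar>g x\<bar>" if "x \<in> \<Omega>" for x
  proof -
    have "M x \<bar>(f x + g x) / 2\<bar> \<le> M x ((1 - 1 / 2) * \<bar>f x\<bar> + 1 / 2 * \<bar>g x\<bar>)"
      using that by (intro mono) auto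
    also have "\<dots> \<le> ennreal (1 - 1 / 2) * M x \<bar>f x\<bar> + ennreal (1 / 2) * M x \<bar>g x\<bar>"
      using that by (intro convex) auto
    also have "\<dots> \<le> 1 * M x \<bar>f x\<bar> + 1 * M x \<bar>g x\<bar>"
      by (intro add_mono mult_right_mono) (simp_all only: ennreal_le_1, simp_all)
    finally show ?thesis by simp
  qed
  then have "modular \<Omega> M (\<lambda>x. (f x + g x) / 2)
      \<le> (\<integral>\<^sup>+x. M x \<bar>f x\<bar> + M x \<bar>g x\<bar> \<partial>lebesgue_on \<Omega>)"
    unfolding modular_def by (intro nn_integral_mono) simp
  also have "\<dots> = modular \<Omega> M f + modular \<Omega> M g"
    unfolding modular_def by (intro nn_integral_add measurable_compose_abs assms)
  finally show ?thesis .
qed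

lemma nn_integral_indicator_compact:
  assumes "compact K" "K \<subseteq> \<Omega>" "0 < c"
  shows "(\<integral>\<^sup>+x. M x c * indicator K x \<partial>lebesgue_on \<Omega>) < \<infinity>"
proof -
  have "K \<in> sets lebesgue" "\<Omega> \<in> sets lebesgue"
    using assms open_domain by (auto intro: lmeasurable_compact fmeasurableD)
  moreover have "indicator K x * indicator \<Omega> x = (indicator K x :: ennreal)" for x
    using assms(2) by (auto simp: indicator_def)
  ultimately have "(\<integral>\<^sup>+x. M x c * indicator K x \<partial>lebesgue_on \<Omega>) = (\<integral>\<^sup>+x. M x c \<partial>lebesgue_on K)"
    by (simp add: nn_integral_restrict_space mult.assoc)
  then show ?thesis
    using locally_integrable[OF assms] by simp
qed

text \<open>A bound \<open>B\<close> of |f| on its support \<open>K\<close> yields the integrable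
  majorant \<open>M x (B / r) * indicator K x\<close>.\<close>

lemma modular_test_function_finite:
  assumes "f \<in> test_functions \<Omega>" "0 < r"
  shows "modular \<Omega> M (\<lambda>x. f x / r) < \<infinity>"
proof -
  define K where "K = closure {x. f x \<noteq> 0}"
  have K: "compact K" "K \<subseteq> \<Omega>" and K0: "\<And>x. x \<notin> K \<Longrightarrow> f x = 0"
    using assms(1) closure_subset[of "{x. f x \<noteq> 0}"] by (auto simp: K_def test_functions_def)
  have "bounded (f ` K)"
    using continuous_on_test_function[OF assms(1)] K(1)
    by (meson compact_continuous_image compact_imp_bounded continuous_on_subset subset_UNIV)
  then obtain B where B: "B > 0" "\<And>x. x \<in> K \<Longrightarrow> \<bar>f x\<bar> \<le> B"
    by (auto simp: bounded_pos)
  have "M x \<bar>f x / r\<bar> \<le> M x (B / r) * indicator K x" if "x \<in> \<Omega>" for x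
    using that K0[of x] B assms(2)
    by (cases "x \<in> K") (auto simp: zero abs_divide divide_right_mono intro!: mono)
  then have "modular \<Omega> M (\<lambda>x. f x / r) \<le> (\<integral>\<^sup>+x. M x (B / r) * indicator K x \<partial>lebesgue_on \<Omega>)"
    unfolding modular_def by (intro nn_integral_mono) simp
  also have "\<dots> < \<infinity>"
    using K B assms(2) by (intro nn_integral_indicator_compact) auto
  finally show ?thesis .
qed

section \<open>Approximation in modular by test functions\<close>

lemma test_function_approximation:
  assumes u [measurable]: "u \<in> borel_measurable (lebesgue_on \<Omega>)"
    and fin: "modular \<Omega> M u < \<infinity>" and "0 < e"
  shows "\<exists>f\<in>test_functions \<Omega>. modular \<Omega> M (\<lambda>x. (f x - u x) / 2) < ennreal e"
proof -
  obtain C where C: "\<And>n. compact (C n)" "\<And>n. C n \<subseteq> \<Omega>"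
    and "\<And>n. C n \<subseteq> interior (C (Suc n))" "\<Union>(range C) = \<Omega>"
    and C_ev: "\<And>K. compact K \<Longrightarrow> K \<subseteq> \<Omega> \<Longrightarrow> \<exists>N. \<forall>n\<ge>N. K \<subseteq> C n"
    by (rule open_Union_compact_subsets[OF open_domain]) blast
  have C_sets: "C n \<in> sets lebesgue" for n
    using C(1) by (intro fmeasurableD lmeasurable_compact)
  have \<Omega>_sets: "\<Omega> \<in> sets lebesgue"
    using open_domain by auto
  have [measurable]: "C n \<in> sets (lebesgue_on \<Omega>)" for n
    using C_sets C(2) \<Omega>_sets by (simp add: sets_restrict_space_iff)
  \<comment> \<open>The truncation takes the value \<open>u x\<close> or 0, so |w - u| never exceeds
    |u|. For fixed \<open>x\<close> it equals \<open>u x\<close> from some index on, which makes the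
    integrand eventually exactly 0.\<close>
  define w where "w = (\<lambda>n x. if x \<in> C n \<and> \<bar>u x\<bar> \<le> real n then u x else 0)"
  have wm: "w n \<in> borel_measurable (lebesgue_on \<Omega>)" for n
    unfolding w_def by measurable
  have "(\<lambda>n. modular \<Omega> M (\<lambda>x. w n x - u x)) \<longlonglongrightarrow> (\<integral>\<^sup>+x. 0 \<partial>lebesgue_on \<Omega>)"
    unfolding modular_def
  proof (rule nn_integral_dominated_convergence)
    show "(\<lambda>x. M x \<bar>w n x - u x\<bar>) \<in> borel_measurable (lebesgue_on \<Omega>)" for n
      using wm by (intro measurable_compose_abs borel_measurable_diff u)
    show "(\<lambda>x. M x \<bar>u x\<bar>) \<in> borel_measurable (lebesgue_on \<Omega>)"
      by (rule measurable_compose_abs[OF u])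
    show "(\<integral>\<^sup>+x. M x \<bar>u x\<bar> \<partial>lebesgue_on \<Omega>) < \<infinity>"
      using fin by (simp add: modular_def)
    show "AE x in lebesgue_on \<Omega>. M x \<bar>w n x - u x\<bar> \<le> M x \<bar>u x\<bar>" for n
      by (rule AE_I2) (auto simp: w_def intro!: mono)
    show "AE x in lebesgue_on \<Omega>. (\<lambda>n. M x \<bar>w n x - u x\<bar>) \<longlonglongrightarrow> 0"
    proof (rule AE_I2)
      fix x assume "x \<in> space (lebesgue_on \<Omega>)"
      then have x: "x \<in> \<Omega>" by simp
      then have "\<forall>\<^sub>F n in sequentially. x \<in> C n"
        using C_ev[of "{x}"] by (auto simp: eventually_sequentially)
      moreover have "\<forall>\<^sub>F n in sequentially. \<bar>u x\<bar> \<le> real n"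
        using filterlim_real_sequentially by (auto simp: filterlim_at_top)
      ultimately have "\<forall>\<^sub>F n in sequentially. M x \<bar>w n x - u x\<bar> = 0"
        by eventually_elim (simp add: w_def zero x)
      then show "(\<lambda>n. M x \<bar>w n x - u x\<bar>) \<longlonglongrightarrow> 0"
        by (rule tendsto_eventually)
    qed
  qed simp
  then have "\<forall>\<^sub>F n in sequentially. modular \<Omega> M (\<lambda>x. w n x - u x) < ennreal (e / 2)"
    using \<open>0 < e\<close> by (intro order_tendstoD) auto
  then obtain n where n: "modular \<Omega> M (\<lambda>x. w n x - u x) < ennreal (e / 2)"
    by (auto simp: eventually_sequentially)
  \<comment> \<open>As \<open>w n\<close> vanishes off \<Omega>, measurability on \<Omega> extends
    to the whole space.\<close>
  have "(\<lambda>x. if x \<in> \<Omega> then w n x else 0) = w n"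
    using C(2) by (auto simp: w_def fun_eq_iff)
  then have wn_lebesgue: "w n \<in> borel_measurable lebesgue"
    using borel_measurable_if_I[OF wm[of n] \<Omega>_sets] by (simp only:)
  have wn: "\<bar>w n x\<bar> \<le> real n" "\<forall>x. x \<notin> C n \<longrightarrow> w n x = 0" for x
    by (auto simp: w_def)
  obtain f L B where f: "\<forall>k. f k \<in> test_functions \<Omega>"
    and L: "compact L" "L \<subseteq> \<Omega>" and fB: "\<forall>k x. \<bar>f k x\<bar> \<le> B"
    and f0: "\<forall>k x. x \<notin> L \<longrightarrow> f k x = 0"
    and lim: "AE x in lebesgue. (\<lambda>k. f k x) \<longlonglongrightarrow> w n x"
    using bounded_measurable_AE_limit_of_test_functions[OF open_domain C(1)[of n] C(2)[of n] wn_lebesgue wn]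
    by (elim exE conjE) (rule that)
  have fm: "f k \<in> borel_measurable (lebesgue_on \<Omega>)" for k
    using f[rule_format] open_domain by (rule borel_measurable_test_function)
  \<comment> \<open>Contains the supports of all \<open>f k\<close> and of \<open>w n\<close>, so
    one majorant serves every \<open>k\<close>.\<close>
  define K where "K = L \<union> C n"
  have K: "compact K" "K \<subseteq> \<Omega>"
    using L C by (auto simp: K_def)
  then have [measurable]: "K \<in> sets (lebesgue_on \<Omega>)"
    using \<Omega>_sets by (simp add: sets_restrict_space_iff fmeasurableD lmeasurable_compact)
  \<comment> \<open>Bounds |f k - w n| everywhere; the summand 1 makes it positive, as local
    integrability demands.\<close>
  define c where "c = \<bar>B\<bar> + real n + 1"
  have "c > 0"
    by (simp add: c_def)
  have "(\<lambda>k. modular \<Omega> M (\<lambda>x. f k x - w n x)) \<longlonglongrightarrow> (\<integral>\<^sup>+x. 0 \<partial>lebesgue_on \<Omega>)"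
    unfolding modular_def
  proof (rule nn_integral_dominated_convergence)
    show "(\<lambda>x. M x \<bar>f k x - w n x\<bar>) \<in> borel_measurable (lebesgue_on \<Omega>)" for k
      by (intro measurable_compose_abs borel_measurable_diff fm wm)
    have [measurable]: "(\<lambda>x. M x c) \<in> borel_measurable (lebesgue_on \<Omega>)"
      using \<open>c > 0\<close> by (simp add: measurable_section)
    show "(\<lambda>x. M x c * indicator K x) \<in> borel_measurable (lebesgue_on \<Omega>)"
      by measurable
    show "(\<integral>\<^sup>+x. M x c * indicator K x \<partial>lebesgue_on \<Omega>) < \<infinity>"
      by (intro nn_integral_indicator_compact K \<open>c > 0\<close>)
    show "AE x in lebesgue_on \<Omega>. M x \<bar>f k x - w n x\<bar> \<le> M x c * indicator K x" for k
    proof (rule AE_I2)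
      fix x assume "x \<in> space (lebesgue_on \<Omega>)"
      then have x: "x \<in> \<Omega>" by simp
      show "M x \<bar>f k x - w n x\<bar> \<le> M x c * indicator K x"
      proof (cases "x \<in> K")
        case True
        have "\<bar>f k x - w n x\<bar> \<le> c"
          using fB[rule_format, of k x] wn(1)[of x] by (simp add: c_def)
        then show ?thesis
          using True x by (simp add: mono)
      next
        case False
        then show ?thesis
          using f0 wn(2) x by (simp add: K_def zero)
      qed
    qed
    have "AE x in lebesgue_on \<Omega>. (\<lambda>k. f k x) \<longlonglongrightarrow> w n x"
      unfolding AE_restrict_space_iff[of \<Omega> lebesgue, simplified, OF \<Omega>_sets]
      using lim by (rule AE_mp) simp
    then show "AE x in lebesgue_on \<Omega>. (\<lambda>k. M x \<bar>f k x - w n x\<bar>) \<longlonglongrightarrow> 0"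
    proof (rule AE_mp, intro AE_I2 impI)
      fix x assume x: "x \<in> space (lebesgue_on \<Omega>)" and "(\<lambda>k. f k x) \<longlonglongrightarrow> w n x"
      then have "(\<lambda>k. \<bar>f k x - w n x\<bar>) \<longlonglongrightarrow> 0"
        by (intro tendsto_rabs_zero LIM_zero)
      with x show "(\<lambda>k. M x \<bar>f k x - w n x\<bar>) \<longlonglongrightarrow> 0"
        by (intro tendsto_at_0) simp_all
    qed
  qed simp
  then have "\<forall>\<^sub>F k in sequentially. modular \<Omega> M (\<lambda>x. f k x - w n x) < ennreal (e / 2)"
    using \<open>0 < e\<close> by (intro order_tendstoD) auto
  then obtain k where k: "modular \<Omega> M (\<lambda>x. f k x - w n x) < ennreal (e / 2)"
    by (auto simp: eventually_sequentially)
  \<comment> \<open>Half of \<open>f k - u\<close> is the average of the two errors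
    \<open>f k - w n\<close> and \<open>w n - u\<close>.\<close>
  have "modular \<Omega> M (\<lambda>x. (f k x - u x) / 2)
      \<le> modular \<Omega> M (\<lambda>x. f k x - w n x) + modular \<Omega> M (\<lambda>x. w n x - u x)"
    using modular_average_le[of "\<lambda>x. f k x - w n x" "\<lambda>x. w n x - u x"] fm wm u by simp
  also have "\<dots> < ennreal (e / 2) + ennreal (e / 2)"
    using k n by (rule add_strict_mono)
  also have "\<dots> = ennreal e"
    using \<open>0 < e\<close> by (simp add: ennreal_plus[symmetric] del: ennreal_plus)
  finally show ?thesis
    using f by blast
qed

text \<open>The approximation is applied to \<open>u / r\<close>, and the resulting test function is
  multiplied by \<open>r\<close>.\<close>

lemma scaled_test_function_approximation:
  assumes "u \<in> borel_measurable (lebesgue_on \<Omega>)" "0 < r"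
    and "modular \<Omega> M (\<lambda>x. u x / r) < \<infinity>" "0 < e"
  shows "\<exists>f\<in>test_functions \<Omega>. modular \<Omega> M (\<lambda>x. (f x - u x) / (2 * r)) < ennreal e"
proof -
  obtain f where f: "f \<in> test_functions \<Omega>"
    and "modular \<Omega> M (\<lambda>x. (f x - u x / r) / 2) < ennreal e"
    using test_function_approximation[of "\<lambda>x. u x / r" e] assms by auto
  moreover have "(\<lambda>x. (f x - u x / r) / 2) = (\<lambda>x. (r * f x - u x) / (2 * r))"
    using assms(2) by (auto simp: field_simps)
  ultimately show ?thesis
    using test_functions_scale[OF f, of r] by (intro bexI[of _ "\<lambda>x. r * f x"]) auto
qed

section \<open>The two density statements for a finite integrand\<close>

lemma test_functions_subset_E_space: "test_functions \<Omega> \<subseteq> E_space \<Omega> M"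
proof
  fix f assume f: "f \<in> test_functions \<Omega>"
  have "f \<in> borel_measurable (lebesgue_on \<Omega>)"
    using f open_domain by (rule borel_measurable_test_function)
  then show "f \<in> E_space \<Omega> M"
    using modular_test_function_finite[OF f] zero_less_one by (auto simp only: E_space_def L_space_def)
qed

lemma norm_dense_test_functions: "norm_dense_in_E \<Omega> M (test_functions \<Omega>)"
  unfolding norm_dense_in_E_def
proof (intro conjI ballI allI impI test_functions_subset_E_space)
  fix u and \<epsilon> :: real assume u: "u \<in> E_space \<Omega> M" and "\<epsilon> > 0"
  \<comment> \<open>In \<open>E_space\<close> every scale is admissible. The choice \<epsilon> / 4
    becomes \<epsilon> / 2 after doubling, which leaves room for a strict inequality in the
    norm.\<close>
  then have "u \<in> borel_measurable (lebesgue_on \<Omega>)" "modular \<Omega> M (\<lambda>x. u x / (\<epsilon> / 4)) < \<infinity>"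
    unfolding E_space_def L_space_def by (auto simp del: divide_divide_eq_right)
  then have "\<exists>f\<in>test_functions \<Omega>. modular \<Omega> M (\<lambda>x. (f x - u x) / (2 * (\<epsilon> / 4))) < ennreal 1"
    using \<open>\<epsilon> > 0\<close> by (intro scaled_test_function_approximation) auto
  then obtain f where f: "f \<in> test_functions \<Omega>"
    and "modular \<Omega> M (\<lambda>x. (f x - u x) / (2 * (\<epsilon> / 4))) < ennreal 1"
    by blast
  then have "\<epsilon> / 2 \<in> {r. r > 0 \<and> modular \<Omega> M (\<lambda>x. (f x - u x) / r) \<le> 1}"
    using \<open>\<epsilon> > 0\<close> by simp
  then have "luxemburg_norm \<Omega> M (\<lambda>x. f x - u x) \<le> \<epsilon> / 2"
    unfolding luxemburg_norm_def by (rule cInf_lower) (auto intro: bdd_belowI[of _ 0])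
  then show "\<exists>f\<in>test_functions \<Omega>. luxemburg_norm \<Omega> M (\<lambda>x. f x - u x) < \<epsilon>"
    using f \<open>\<epsilon> > 0\<close> by (intro bexI[of _ f]) auto
qed

lemma modular_dense_test_functions: "modular_dense_in_L \<Omega> M (test_functions \<Omega>)"
  unfolding modular_dense_in_L_def
proof (intro conjI ballI)
  show "test_functions \<Omega> \<subseteq> L_space \<Omega> M"
    using test_functions_subset_E_space by (auto simp: E_space_def)
  fix u assume "u \<in> L_space \<Omega> M"
  then obtain r where r: "r > 0" "modular \<Omega> M (\<lambda>x. u x / r) < \<infinity>"
    and u: "u \<in> borel_measurable (lebesgue_on \<Omega>)"
    by (auto simp: L_space_def)
  \<comment> \<open>Membership in \<open>L_space\<close> provides one scale \<open>r\<close>, so the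
    error shrinks at the fixed scale \<open>2 * r\<close>; this is modular convergence.\<close>
  have "\<forall>n. \<exists>f. f \<in> test_functions \<Omega> \<and> modular \<Omega> M (\<lambda>x. (f x - u x) / (2 * r)) < ennreal (1 / Suc n)"
    using scaled_test_function_approximation[OF u r] by (simp add: Bex_def)
  from choice[OF this] obtain U where U: "\<forall>n. U n \<in> test_functions \<Omega> \<and>
      modular \<Omega> M (\<lambda>x. (U n x - u x) / (2 * r)) < ennreal (1 / Suc n)"
    by (rule exE)
  have "(\<lambda>n. ennreal (1 / Suc n)) \<longlonglongrightarrow> ennreal 0"
    by (intro tendsto_ennrealI LIMSEQ_Suc[OF lim_1_over_n])
  then have upper: "(\<lambda>n. ennreal (1 / Suc n)) \<longlonglongrightarrow> 0"
    by (simp only: ennreal_0)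
  have "(\<lambda>n. modular \<Omega> M (\<lambda>x. (U n x - u x) / (2 * r))) \<longlonglongrightarrow> 0"
  proof (rule tendsto_sandwich[OF _ _ tendsto_const upper])
    show "\<forall>\<^sub>F n in sequentially. modular \<Omega> M (\<lambda>x. (U n x - u x) / (2 * r)) \<le> ennreal (1 / Suc n)"
      using U by (intro always_eventually allI less_imp_le) blast
  qed simp
  moreover have "2 * r > 0"
    using r(1) by simp
  ultimately have "modular_convergent \<Omega> M U u"
    unfolding modular_convergent_def by blast
  then show "\<exists>U. (\<forall>n. U n \<in> test_functions \<Omega>) \<and> modular_convergent \<Omega> M U u"
    using U by blast
qed

end

section \<open>Reduction to an integrand that is finite everywhere\<close>

lemma locally_integrable_phi_AE_finite:
  assumes "open \<Omega>" "phi_function \<Omega> M" "locally_integrable_phi \<Omega> M"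
  shows "AE x in lebesgue_on \<Omega>. \<forall>n. M x (real n) < \<infinity>"
proof -
  obtain C where C: "\<And>n. compact (C n)" "\<And>n. C n \<subseteq> \<Omega>"
    and "\<And>n. C n \<subseteq> interior (C (Suc n))" and C_Union: "\<Union>(range C) = \<Omega>"
    and "\<And>K. compact K \<Longrightarrow> K \<subseteq> \<Omega> \<Longrightarrow> \<exists>N. \<forall>n\<ge>N. K \<subseteq> C n"
    by (rule open_Union_compact_subsets[OF assms(1)]) blast
  have C_sets: "C n \<in> sets lebesgue" for n
    using C(1) by (intro fmeasurableD lmeasurable_compact)
  \<comment> \<open>Compact sets of the exhaustion and integer levels leave countably many null
    sets. Only positive levels are treated here, as in the definition of local integrability; level
    0 follows from \<open>M x 0 = 0\<close>.\<close>
  have "AE x in lebesgue. x \<in> C k \<longrightarrow> M x (real (Suc n)) < \<infinity>" for k n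
  proof -
    have "(\<lambda>x. M x (real (Suc n))) \<in> borel_measurable (lebesgue_on \<Omega>)"
      using assms(2) by (auto simp: phi_function_def)
    then have "(\<lambda>x. M x (real (Suc n))) \<in> borel_measurable (lebesgue_on (C k))"
      using C(2) by (rule measurable_restrict_mono)
    moreover have "(\<integral>\<^sup>+x. M x (real (Suc n)) \<partial>lebesgue_on (C k)) \<noteq> \<infinity>"
      using assms(3) C(1,2) unfolding locally_integrable_phi_def by (metis less_irrefl of_nat_0_less_iff zero_less_Suc)
    ultimately have "AE x in lebesgue_on (C k). M x (real (Suc n)) \<noteq> \<infinity>"
      by (rule nn_integral_PInf_AE)
    then show ?thesis
      using C_sets by (simp add: AE_restrict_space_iff less_top)
  qed
  then have "AE x in lebesgue. \<forall>k n. x \<in> C k \<longrightarrow> M x (real (Suc n)) < \<infinity>"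
    unfolding AE_all_countable by blast
  then have "AE x in lebesgue. x \<in> \<Omega> \<longrightarrow> (\<forall>n. M x (real n) < \<infinity>)"
  proof (rule AE_mp, intro AE_I2 impI allI)
    fix x n
    assume *: "\<forall>k n. x \<in> C k \<longrightarrow> M x (real (Suc n)) < \<infinity>" and x: "x \<in> \<Omega>"
    show "M x (real n) < \<infinity>"
    proof (cases n)
      case 0
      then show ?thesis
        using x assms(2) by (simp add: phi_function_def)
    next
      case (Suc m)
      obtain k where "x \<in> C k"
        using x C_Union by blast
      then show ?thesis
        using * Suc by blast
    qed
  qed
  moreover have "\<Omega> \<inter> space lebesgue \<in> sets lebesgue"
    using assms(1) by simp
  ultimately show ?thesis
    by (simp only: AE_restrict_space_iff)
qed

theorem theorem1p1:
  fixes \<Omega> :: "(real ^ 'n) set"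
    and M :: "real ^ 'n \<Rightarrow> real \<Rightarrow> ennreal"
  assumes "open \<Omega>"
    and "Phi_function \<Omega> M"
    and "locally_integrable_phi \<Omega> M"
  shows "norm_dense_in_E \<Omega> M (test_functions \<Omega>) \<and>
         modular_dense_in_L \<Omega> M (test_functions \<Omega>)"
proof -
  have phi: "phi_function \<Omega> M"
    using assms(2) by (simp add: Phi_function_def)
  \<comment> \<open>For \<open>x\<close> in a null set \<open>M x\<close> may take the value \<open>\<infinity>\<close>; replacing it by \<open>0\<close> there preserves the modular.\<close>
  define G where "G = {x \<in> \<Omega>. \<forall>n. M x (real n) < \<infinity>}"
  define M' where "M' = (\<lambda>x s. if x \<in> G then M x s else 0)"
  have phiD: "mono_on {0..} (M x)" "M x 0 = 0"
    "\<And>s t \<theta>. s \<ge> 0 \<Longrightarrow> t \<ge> 0 \<Longrightarrow> \<theta> \<in> {0..1} \<Longrightarrow>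
       M x ((1 - \<theta>) * s + \<theta> * t) \<le> ennreal (1 - \<theta>) * M x s + ennreal \<theta> * M x t" if "x \<in> G" for x
    using phi that by (auto simp: phi_function_def G_def)
  have section_meas: "(\<lambda>x. M x s) \<in> borel_measurable (lebesgue_on \<Omega>)" if "s \<ge> 0" for s
    using phi that by (auto simp: phi_function_def)
  interpret finite_convex_integrand \<Omega> M'
  proof
    show "open \<Omega>" by fact
    show "M' x s \<le> M' x t" if "0 \<le> s" "s \<le> t" for x s t
      using that phiD(1)[of x] by (auto simp: M'_def mono_on_def)
    show "M' x ((1 - \<theta>) * s + \<theta> * t) \<le> ennreal (1 - \<theta>) * M' x s + ennreal \<theta> * M' x t"
      if "0 \<le> s" "0 \<le> t" "0 \<le> \<theta>" "\<theta> \<le> 1" for x s t \<theta>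
      using that phiD(3)[of x] by (auto simp: M'_def)
    show "M' x 0 = 0" for x
      using phiD(2) by (simp add: M'_def)
    show "M' x s < \<infinity>" if "0 \<le> s" for x s
    proof (cases "x \<in> G")
      case True
      \<comment> \<open>By monotonicity, finiteness at the integers spreads to every
        \<open>s \<ge> 0\<close>.\<close>
      have "M x s \<le> M x (real (nat \<lceil>s\<rceil>))"
        using that by (intro mono_onD[OF phiD(1)[OF True]]) (auto simp: of_nat_ceiling)
      also have "\<dots> < \<infinity>"
        using True by (simp add: G_def)
      finally show ?thesis
        using True by (simp add: M'_def)
    qed (simp add: M'_def)
    show "(\<lambda>x. M' x s) \<in> borel_measurable (lebesgue_on \<Omega>)" if "0 \<le> s" for s
    proof -
      note section_meas[OF that, measurable]
      have [measurable]: "(\<lambda>x. M x (real n)) \<in> borel_measurable (lebesgue_on \<Omega>)" for n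
        by (intro section_meas) simp
      have "G = {x \<in> space (lebesgue_on \<Omega>). \<forall>n. M x (real n) < \<infinity>}"
        by (simp add: G_def)
      also have "\<dots> \<in> sets (lebesgue_on \<Omega>)"
        by measurable
      finally have [measurable]: "G \<in> sets (lebesgue_on \<Omega>)" .
      show ?thesis
        unfolding M'_def by measurable
    qed
    show "(\<integral>\<^sup>+x. M' x c \<partial>lebesgue_on K) < \<infinity>" if "compact K" "K \<subseteq> \<Omega>" "0 < c" for K c
    proof -
      have "(\<integral>\<^sup>+x. M' x c \<partial>lebesgue_on K) \<le> (\<integral>\<^sup>+x. M x c \<partial>lebesgue_on K)"
        by (intro nn_integral_mono) (simp add: M'_def)
      also have "\<dots> < \<infinity>"
        using assms(3) that by (auto simp: locally_integrable_phi_def)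
      finally show ?thesis .
    qed
  qed
  have "AE x in lebesgue_on \<Omega>. x \<in> G"
    using locally_integrable_phi_AE_finite[OF assms(1) phi assms(3)] AE_space
    by eventually_elim (simp add: G_def)
  then have "modular \<Omega> M u = modular \<Omega> M' u" for u
    unfolding modular_def by (intro nn_integral_cong_AE) (rule AE_mp, assumption, simp add: M'_def)
  \<comment> \<open>The spaces, the norm and modular convergence see the integrand only through its
    modular, so both density statements carry over to \<open>M\<close>.\<close>
  then have modular_eq: "modular \<Omega> M = modular \<Omega> M'" ..
  have L: "L_space \<Omega> M = L_space \<Omega> M'"
    by (simp add: L_space_def modular_eq)
  then have E: "E_space \<Omega> M = E_space \<Omega> M'"
    by (simp add: E_space_def modular_eq)
  show ?thesis
    using norm_dense_test_functions modular_dense_test_functions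
    by (simp add: norm_dense_in_E_def modular_dense_in_L_def luxemburg_norm_def modular_convergent_def
        L E modular_eq)
qed

end
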